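(* For the EOP-SAV/CN scheme described in the context, the modified energy $\widetilde{\mathcal E}(\phi^{n+1})=\frac12(\mathcal L\phi^{n+1},\phi^{n+1})+|R^{n+1}|^2-C$ is optimal from a relaxation point of view, in the following sense. For every $\Delta t>0$ and $n\ge0$ there exists $\lambda\in[0,1]$ such that $$R^{n+1}=\lambda\widetilde R^{n+1}+(1-\lambda)\sqrt{\mathcal E_1(\phi^{n+1})},$$ and among all relaxed values $R_{\lambda'}=\lambda'\widetilde R^{n+1}+(1-\lambda')\sqrt{\mathcal E_1(\phi^{n+1})}$, $\lambda'\in[0,1]$, that satisfy the energy dissipative law $$\tfrac12(\mathcal L\phi^{n+1},\phi^{n+1})+R_{\lambda'}^2\le\tfrac12(\mathcal L\phi^{n},\phi^{n})+|R^{n}|^2,$$ the value $R^{n+1}$ (which satisfies this law) makes the modified energy closest to the original energy $\mathcal E(\phi^{n+1})=\frac12(\mathcal L\phi^{n+1},\phi^{n+1})+E_1(\phi^{n+1})$, i.e. $$\left|\widetilde{\mathcal E}(\phi^{n+1})-\mathcal E(\phi^{n+1})\right|\le\left|\tfrac12(\mathcal L\phi^{n+1},\phi^{n+1})+R_{\lambda'}^2-C-\mathcal E(\phi^{n+1})\right| .$$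
   Context: Setting: $\Omega$ is the spatial domain and $(\cdot,\cdot)$ is the $L^2(\Omega)$ inner product. The free energy is $E(\phi)=\frac12(\phi,\mathcal L\phi)+E_1(\phi)$ with $E_1(\phi)=\int_\Omega F(\phi)\,d\mathbf x$, where $\mathcal L$ is a symmetric non-negative linear operator and $F$ is a differentiable energy density with derivative $F'$. The gradient flow is $\partial_t\phi=-\mathcal G\mu$, $\mu=\mathcal L\phi+F'(\phi)$, with $\mathcal G$ a positive linear operator (so $(\mathcal G\mu,\mu)\ge0$). It is assumed that $E_1$ is bounded below: $E_1(\phi)>-C$ for all $\phi$, for a constant $C>0$. Put $\mathcal E_1(\phi)=E_1(\phi)+C>0$. EOP-SAV/CN scheme: set $\phi^0=\phi_0$, $R^0=\sqrt{E_1(\phi_0)+C}$ ($\phi^{-1}$ is a given starting value used only in the extrapolation at $n=0$). For $n\ge0$, with $\widehat\phi^{n+\frac12}=\frac32\phi^n-\frac12\phi^{n-1}$: Step I: $\phi^{n+1},\mu^{n+\frac12},\widetilde R^{n+1}$ (with $\widetilde R^{n+1}\in\mathbb R$) solve $$\frac{\phi^{n+1}-\phi^n}{\Delta t}=-\mathcal G\mu^{n+\frac12},$$ $$\mu^{n+\frac12}=\tfrac12\mathcal L\phi^{n+1}+\tfrac12\mathcal L\phi^n+\frac{\widetilde R^{n+1}+R^n}{2\sqrt{\mathcal E_1(\widehat\phi^{n+\frac12})}}F'(\widehat\phi^{n+\frac12}),$$ $$\frac{\widetilde R^{n+1}-R^n}{\Delta t}=\frac{1}{2\sqrt{\mathcal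 E_1(\widehat\phi^{n+\frac12})}}\left(F'(\widehat\phi^{n+\frac12}),\frac{\phi^{n+1}-\phi^n}{\Delta t}\right).$$ Step II: $R^{n+1}=\min\{s^{n+1},\sqrt{\mathcal E_1(\phi^{n+1})}\}$ with $s^{n+1}=\sqrt{\frac12(\mathcal L\phi^{n},\phi^{n})-\frac12(\mathcal L\phi^{n+1},\phi^{n+1})+|R^{n}|^2}$ (the radicand is non-negative for solutions of Step I). The functions $\phi^n,\mu^{n+\frac12}$ are assumed regular enough that all expressions make sense. *)

theory Defs
  imports "HOL-Analysis.Analysis"
begin

text \<open>
  Elements of \<open>L\<^sup>2(\<Omega>)\<close> are represented by real functions on the ambient space, of which only
  the restriction to \<open>\<Omega>\<close> matters; accordingly, equations between them are required to hold
  almost everywhere on \<open>\<Omega>\<close>.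
\<close>

definition square_integrable :: "'a::euclidean_space set \<Rightarrow> ('a \<Rightarrow> real) set" where
  "square_integrable \<Omega> =
     {f \<in> borel_measurable (lebesgue_on \<Omega>). integrable (lebesgue_on \<Omega>) (\<lambda>x. (f x)\<^sup>2)}"

definition L2_inner :: "'a::euclidean_space set \<Rightarrow> ('a \<Rightarrow> real) \<Rightarrow> ('a \<Rightarrow> real) \<Rightarrow> real" where
  "L2_inner \<Omega> f g = (LINT x|lebesgue_on \<Omega>. f x * g x)"

text \<open>
  A possibly unbounded linear operator \<open>A\<close> on \<open>L\<^sup>2(\<Omega>)\<close> whose domain is the subspace \<open>D\<close>;
  boundary conditions are part of the choice of \<open>D\<close>.
\<close>

definition linear_operator_on ::
    "'a::euclidean_space set \<Rightarrow> ('a \<Rightarrow> real) set \<Rightarrow> (('a \<Rightarrow> real) \<Rightarrow> 'a \<Rightarrow> real) \<Rightarrow> bool" where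
  "linear_operator_on \<Omega> D A \<longleftrightarrow>
     D \<subseteq> square_integrable \<Omega> \<and>
     (\<lambda>x. 0) \<in> D \<and>
     (\<forall>f\<in>D. \<forall>g\<in>D. \<forall>a b. (\<lambda>x. a * f x + b * g x) \<in> D) \<and>
     (\<forall>f\<in>D. A f \<in> square_integrable \<Omega>) \<and>
     (\<forall>f\<in>D. \<forall>g\<in>D. \<forall>a b. AE x in lebesgue_on \<Omega>.
        A (\<lambda>x. a * f x + b * g x) x = a * A f x + b * A g x)"

definition E1 :: "'a::euclidean_space set \<Rightarrow> (real \<Rightarrow> real) \<Rightarrow> ('a \<Rightarrow> real) \<Rightarrow> real" where
  "E1 \<Omega> F \<phi> = (LINT x|lebesgue_on \<Omega>. F (\<phi> x))"

definition shifted_E1 ::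
    "'a::euclidean_space set \<Rightarrow> (real \<Rightarrow> real) \<Rightarrow> real \<Rightarrow> ('a \<Rightarrow> real) \<Rightarrow> real" where
  "shifted_E1 \<Omega> F C \<phi> = E1 \<Omega> F \<phi> + C"

definition free_energy ::
    "'a::euclidean_space set \<Rightarrow> (('a \<Rightarrow> real) \<Rightarrow> 'a \<Rightarrow> real) \<Rightarrow> (real \<Rightarrow> real) \<Rightarrow> ('a \<Rightarrow> real) \<Rightarrow> real"
  where "free_energy \<Omega> L F \<phi> = 1/2 * L2_inner \<Omega> (L \<phi>) \<phi> + E1 \<Omega> F \<phi>"

definition modified_energy ::
    "'a::euclidean_space set \<Rightarrow> (('a \<Rightarrow> real) \<Rightarrow> 'a \<Rightarrow> real) \<Rightarrow> real \<Rightarrow> ('a \<Rightarrow> real) \<Rightarrow> real \<Rightarrow> real"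
  where "modified_energy \<Omega> L C \<phi> r = 1/2 * L2_inner \<Omega> (L \<phi>) \<phi> + r\<^sup>2 - C"

text \<open>
  The lower bound on \<open>E1\<close> is imposed on the functions at which the free energy is defined:
  those in the domain of \<open>L\<close> whose energy density is integrable.
\<close>

locale gradient_flow =
  fixes \<Omega> :: "'a::euclidean_space set"
    and D\<^sub>L :: "('a \<Rightarrow> real) set" and L :: "('a \<Rightarrow> real) \<Rightarrow> 'a \<Rightarrow> real"
    and D\<^sub>G :: "('a \<Rightarrow> real) set" and G :: "('a \<Rightarrow> real) \<Rightarrow> 'a \<Rightarrow> real"
    and F F' :: "real \<Rightarrow> real"
    and C :: real
  assumes domain: "open \<Omega>" "connected \<Omega>" "\<Omega> \<noteq> {}"
    and L_linear: "linear_operator_on \<Omega> D\<^sub>L L"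
    and L_symmetric:
      "\<And>f g. f \<in> D\<^sub>L \<Longrightarrow> g \<in> D\<^sub>L \<Longrightarrow> L2_inner \<Omega> (L f) g = L2_inner \<Omega> f (L g)"
    and L_nonneg: "\<And>f. f \<in> D\<^sub>L \<Longrightarrow> L2_inner \<Omega> (L f) f \<ge> 0"
    and G_linear: "linear_operator_on \<Omega> D\<^sub>G G"
    and G_positive: "\<And>f. f \<in> D\<^sub>G \<Longrightarrow> L2_inner \<Omega> (G f) f \<ge> 0"
    and F_deriv: "\<And>u. (F has_real_derivative F' u) (at u)"
    and C_pos: "C > 0"
    and E1_bound:
      "\<And>\<phi>. \<phi> \<in> D\<^sub>L \<Longrightarrow> integrable (lebesgue_on \<Omega>) (\<lambda>x. F (\<phi> x)) \<Longrightarrow> E1 \<Omega> F \<phi> > - C"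

text \<open>
  \<open>\<phi>\<^sub>p\<close> is the starting value with index \<open>-1\<close>, and \<open>extrapolation \<phi>\<^sub>p \<phi> n\<close> has index \<open>n + 1/2\<close>.
\<close>

definition extrapolation :: "('a \<Rightarrow> real) \<Rightarrow> (nat \<Rightarrow> 'a \<Rightarrow> real) \<Rightarrow> nat \<Rightarrow> 'a \<Rightarrow> real" where
  "extrapolation \<phi>\<^sub>p \<phi> n = (\<lambda>x. 3/2 * \<phi> n x - 1/2 * (if n = 0 then \<phi>\<^sub>p else \<phi> (n - 1)) x)"

text \<open>
  \<open>\<mu> n\<close> has index \<open>n + 1/2\<close>, and \<open>Rt\<close> is the intermediate scalar of Step I, with \<open>Rt 0\<close> unused.
  The assumptions from \<open>start_regular\<close> to \<open>\<mu>_regular\<close> are the regularity needed for all the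
  expressions of the scheme to make sense.
\<close>

locale EOP_SAV_CN = gradient_flow \<Omega> D\<^sub>L L D\<^sub>G G F F' C
  for \<Omega> :: "'a::euclidean_space set"
    and D\<^sub>L L D\<^sub>G G F F' C +
  fixes dt :: real
    and \<phi>\<^sub>0 \<phi>\<^sub>p :: "'a \<Rightarrow> real"
    and \<phi> \<mu> :: "nat \<Rightarrow> 'a \<Rightarrow> real"
    and Rt R :: "nat \<Rightarrow> real"
  assumes start_regular: "\<phi>\<^sub>p \<in> D\<^sub>L"
    and \<phi>_regular: "\<And>n. \<phi> n \<in> D\<^sub>L" "\<And>n. integrable (lebesgue_on \<Omega>) (\<lambda>x. F (\<phi> n x))"
    and extrapolation_regular:
      "\<And>n. integrable (lebesgue_on \<Omega>) (\<lambda>x. F (extrapolation \<phi>\<^sub>p \<phi> n x))"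
      "\<And>n. (\<lambda>x. F' (extrapolation \<phi>\<^sub>p \<phi> n x)) \<in> square_integrable \<Omega>"
    and \<mu>_regular: "\<And>n. \<mu> n \<in> D\<^sub>G"
    and initial: "\<phi> 0 = \<phi>\<^sub>0" "R 0 = sqrt (E1 \<Omega> F \<phi>\<^sub>0 + C)"
    and step1_\<phi>:
      "\<And>n. AE x in lebesgue_on \<Omega>. (\<phi> (n + 1) x - \<phi> n x) / dt = - G (\<mu> n) x"
    and step1_\<mu>:
      "\<And>n. AE x in lebesgue_on \<Omega>.
         \<mu> n x = 1/2 * L (\<phi> (n + 1)) x + 1/2 * L (\<phi> n) x
           + (Rt (n + 1) + R n) / (2 * sqrt (shifted_E1 \<Omega> F C (extrapolation \<phi>\<^sub>p \<phi> n)))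
             * F' (extrapolation \<phi>\<^sub>p \<phi> n x)"
    and step1_R:
      "\<And>n. (Rt (n + 1) - R n) / dt =
         1 / (2 * sqrt (shifted_E1 \<Omega> F C (extrapolation \<phi>\<^sub>p \<phi> n)))
           * L2_inner \<Omega> (\<lambda>x. F' (extrapolation \<phi>\<^sub>p \<phi> n x)) (\<lambda>x. (\<phi> (n + 1) x - \<phi> n x) / dt)"
    and step2:
      "\<And>n. R (n + 1) =
         min (sqrt (1/2 * L2_inner \<Omega> (L (\<phi> n)) (\<phi> n)
                    - 1/2 * L2_inner \<Omega> (L (\<phi> (n + 1))) (\<phi> (n + 1)) + \<bar>R n\<bar>\<^sup>2))
             (sqrt (shifted_E1 \<Omega> F C (\<phi> (n + 1))))"

definition relaxed_R ::
    "'a::euclidean_space set \<Rightarrow> (real \<Rightarrow> real) \<Rightarrow> real \<Rightarrow> ('a \<Rightarrow> real) \<Rightarrow> real \<Rightarrow> real \<Rightarrow> real" where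
  "relaxed_R \<Omega> F C \<phi> r l = l * r + (1 - l) * sqrt (shifted_E1 \<Omega> F C \<phi>)"

definition dissipative_law ::
    "'a::euclidean_space set \<Rightarrow> (('a \<Rightarrow> real) \<Rightarrow> 'a \<Rightarrow> real)
      \<Rightarrow> ('a \<Rightarrow> real) \<Rightarrow> real \<Rightarrow> ('a \<Rightarrow> real) \<Rightarrow> real \<Rightarrow> bool" where
  "dissipative_law \<Omega> L \<phi> r \<psi> q \<longleftrightarrow>
     1/2 * L2_inner \<Omega> (L \<psi>) \<psi> + q\<^sup>2 \<le> 1/2 * L2_inner \<Omega> (L \<phi>) \<phi> + r\<^sup>2"

end

theory Submission
  imports Defs
begin

text \<open>
  Testing Step I against \<open>\<mu>\<close> and using the symmetry of \<open>L\<close> and the positivity of \<open>G\<close> shows that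
  \<open>Rt\<^sup>2 \<le> s\<^sup>2\<close>, where \<open>s\<^sup>2\<close> is the radicand of Step II; in particular \<open>Rt \<le> s\<close>. Hence
  \<open>min s S\<close>, with \<open>S\<^sup>2\<close> the shifted energy, lies between \<open>Rt\<close> and \<open>S\<close> or equals \<open>S\<close>, and the
  claim is that \<open>min s S\<close> is the point of \<open>[-s, s]\<close> whose square is closest to \<open>S\<^sup>2\<close>.
\<close>

lemma integrable_mult_square_integrable:
  assumes "f \<in> square_integrable \<Omega>" "g \<in> square_integrable \<Omega>"
  shows "integrable (lebesgue_on \<Omega>) (\<lambda>x. f x * g x)"
proof (rule Bochner_Integration.integrable_bound)
  show "integrable (lebesgue_on \<Omega>) (\<lambda>x. (f x)\<^sup>2 + (g x)\<^sup>2)"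
    using assms by (auto simp: square_integrable_def)
  show "(\<lambda>x. f x * g x) \<in> borel_measurable (lebesgue_on \<Omega>)"
    using assms by (auto simp: square_integrable_def)
  have "\<bar>a * b\<bar> \<le> \<bar>a\<^sup>2 + b\<^sup>2\<bar>" for a b :: real
  proof -
    have "2 * \<bar>a * b\<bar> \<le> a\<^sup>2 + b\<^sup>2"
      using sum_squares_bound[of "\<bar>a\<bar>" "\<bar>b\<bar>"] by (simp add: abs_mult)
    then show ?thesis by linarith
  qed
  then show "AE x in lebesgue_on \<Omega>. norm (f x * g x) \<le> norm ((f x)\<^sup>2 + (g x)\<^sup>2)"
    by simp
qed

lemma square_integrable_linear_combination:
  assumes "f \<in> square_integrable \<Omega>" "g \<in> square_integrable \<Omega>"
  shows "(\<lambda>x. a * f x + b * g x) \<in> square_integrable \<Omega>"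
proof -
  have "integrable (lebesgue_on \<Omega>) (\<lambda>x. a\<^sup>2 * (f x)\<^sup>2 + 2 * a * b * (f x * g x) + b\<^sup>2 * (g x)\<^sup>2)"
    using assms integrable_mult_square_integrable[OF assms]
    by (auto simp: square_integrable_def)
  moreover have "(\<lambda>x. a\<^sup>2 * (f x)\<^sup>2 + 2 * a * b * (f x * g x) + b\<^sup>2 * (g x)\<^sup>2)
      = (\<lambda>x. (a * f x + b * g x)\<^sup>2)"
    by (simp add: fun_eq_iff power2_eq_square algebra_simps)
  ultimately show ?thesis
    using assms by (auto simp: square_integrable_def)
qed

lemma L2_inner_commute: "L2_inner \<Omega> f g = L2_inner \<Omega> g f"
  by (simp add: L2_inner_def mult.commute)

lemma L2_inner_linear_left:
  assumes "f \<in> square_integrable \<Omega>" "g \<in> square_integrable \<Omega>" "h \<in> square_integrable \<Omega>"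
  shows "L2_inner \<Omega> (\<lambda>x. a * f x + b * g x) h = a * L2_inner \<Omega> f h + b * L2_inner \<Omega> g h"
  using integrable_mult_square_integrable[OF assms(1,3)]
    integrable_mult_square_integrable[OF assms(2,3)]
  by (simp add: L2_inner_def algebra_simps)

lemma L2_inner_linear_right:
  assumes "f \<in> square_integrable \<Omega>" "g \<in> square_integrable \<Omega>" "h \<in> square_integrable \<Omega>"
  shows "L2_inner \<Omega> h (\<lambda>x. a * f x + b * g x) = a * L2_inner \<Omega> h f + b * L2_inner \<Omega> h g"
  using L2_inner_linear_left[OF assms] by (simp add: L2_inner_commute[of \<Omega> h])

text \<open>The equations of Step I hold only almost everywhere, and this carries them into inner
  products. Square integrability supplies the measurability of the integrands.\<close>

lemma L2_inner_cong_AE: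
  assumes "f \<in> square_integrable \<Omega>" "f' \<in> square_integrable \<Omega>"
    and "g \<in> square_integrable \<Omega>" "g' \<in> square_integrable \<Omega>"
    and "AE x in lebesgue_on \<Omega>. f x = f' x" "AE x in lebesgue_on \<Omega>. g x = g' x"
  shows "L2_inner \<Omega> f g = L2_inner \<Omega> f' g'"
  unfolding L2_inner_def
proof (rule integral_cong_AE)
  show "AE x in lebesgue_on \<Omega>. f x * g x = f' x * g' x"
    using assms(5,6) by eventually_elim simp
qed (use assms(1-4) in \<open>auto simp: square_integrable_def\<close>)

lemma linear_operator_onD:
  assumes "linear_operator_on \<Omega> D A" "f \<in> D"
  shows "f \<in> square_integrable \<Omega>" "A f \<in> square_integrable \<Omega>"
  using assms by (auto simp: linear_operator_on_def)

text \<open>By symmetry of \<open>L\<close> the mixed terms \<open>(L g, f)\<close> and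
  \<open>(L f, g)\<close> cancel. This is why the Crank-Nicolson average of \<open>L\<close> yields
  an exact difference of quadratic energies; \<open>a\<close> will be \<open>1/dt\<close>.\<close>

lemma (in gradient_flow) L_quadratic_diff:
  assumes "f \<in> D\<^sub>L" "g \<in> D\<^sub>L"
  shows "L2_inner \<Omega> (\<lambda>x. 1/2 * L g x + 1/2 * L f x) (\<lambda>x. a * g x + - a * f x)
    = a * (1/2 * L2_inner \<Omega> (L g) g - 1/2 * L2_inner \<Omega> (L f) f)"
proof -
  note sq = linear_operator_onD[OF L_linear assms(1)] linear_operator_onD[OF L_linear assms(2)]
  have "L2_inner \<Omega> (L g) f = L2_inner \<Omega> (L f) g"
    using L_symmetric[OF assms(2,1)] by (simp add: L2_inner_commute)
  then show ?thesis
    unfolding L2_inner_linear_left[OF sq(4,2) square_integrable_linear_combination[OF sq(3,1)]]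
      L2_inner_linear_right[OF sq(3,1,4)] L2_inner_linear_right[OF sq(3,1,2)]
    by (simp add: algebra_simps)
qed

text \<open>The energy drop is exactly \<open>dt * (G \<mu>, \<mu>)\<close>: each inner product
  arising from the equations of Step I is a difference quotient of one energy contribution.\<close>

lemma (in EOP_SAV_CN) step1_dissipation:
  assumes "dt > 0"
  shows "1/2 * L2_inner \<Omega> (L (\<phi> (n + 1))) (\<phi> (n + 1)) + (Rt (n + 1))\<^sup>2
    \<le> 1/2 * L2_inner \<Omega> (L (\<phi> n)) (\<phi> n) + (R n)\<^sup>2"
proof -
  define c where "c = 1 / (2 * sqrt (shifted_E1 \<Omega> F C (extrapolation \<phi>\<^sub>p \<phi> n)))"
  define f where "f = (\<lambda>x. F' (extrapolation \<phi>\<^sub>p \<phi> n x))"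
  define d where "d = (\<lambda>x. (1/dt) * \<phi> (n + 1) x + - (1/dt) * \<phi> n x)"
  define l where "l = (\<lambda>x. 1/2 * L (\<phi> (n + 1)) x + 1/2 * L (\<phi> n) x)"
  define m where "m = (\<lambda>x. 1 * l x + ((Rt (n + 1) + R n) * c) * f x)"
  have d_eq: "(\<lambda>x. (\<phi> (n + 1) x - \<phi> n x) / dt) = d"
    by (simp add: d_def fun_eq_iff diff_divide_distrib)
  note sq\<phi> = linear_operator_onD[OF L_linear \<phi>_regular(1)]
  note sq\<mu> = linear_operator_onD[OF G_linear \<mu>_regular[of n]]
  have f: "f \<in> square_integrable \<Omega>" using extrapolation_regular(2) by (simp add: f_def)
  have d: "d \<in> square_integrable \<Omega>" and l: "l \<in> square_integrable \<Omega>"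
    unfolding d_def l_def by (intro square_integrable_linear_combination sq\<phi>)+
  have m: "m \<in> square_integrable \<Omega>"
    unfolding m_def by (intro square_integrable_linear_combination f l)
  \<comment> \<open>This is \<open>-d\<close>, written as a linear combination so that the closure
    and linearity lemmas match it literally; the factor 1 in \<open>m\<close> serves the same
    end.\<close>
  have nd: "(\<lambda>x. (-1) * d x + 0 * d x) \<in> square_integrable \<Omega>"
    by (intro square_integrable_linear_combination d)
  have "AE x in lebesgue_on \<Omega>. G (\<mu> n) x = (-1) * d x + 0 * d x"
    using step1_\<phi>[of n] unfolding d_eq[THEN fun_cong] by eventually_elim simp
  moreover have "AE x in lebesgue_on \<Omega>. \<mu> n x = m x"
    using step1_\<mu>[of n] by (simp add: m_def l_def f_def c_def)
  ultimately have "L2_inner \<Omega> (G (\<mu> n)) (\<mu> n) = L2_inner \<Omega> (\<lambda>x. (-1) * d x + 0 * d x) m"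
    by (intro L2_inner_cong_AE sq\<mu> nd m)
  also have "\<dots> = - L2_inner \<Omega> m d"
    unfolding L2_inner_linear_left[OF d d m] by (simp add: L2_inner_commute)
  also have "L2_inner \<Omega> m d = L2_inner \<Omega> l d + (Rt (n + 1) + R n) * (c * L2_inner \<Omega> f d)"
    unfolding m_def L2_inner_linear_left[OF l f d] by simp
  \<comment> \<open>The scalar equation of Step I turns the nonlinear term into
    \<open>(Rt + R) * (Rt - R) / dt\<close>, a difference of squares.\<close>
  also have "c * L2_inner \<Omega> f d = (Rt (n + 1) - R n) / dt"
    using step1_R[of n] unfolding d_eq by (simp add: c_def f_def)
  also have "L2_inner \<Omega> l d = (1/dt) * (1/2 * L2_inner \<Omega> (L (\<phi> (n + 1))) (\<phi> (n + 1))
      - 1/2 * L2_inner \<Omega> (L (\<phi> n)) (\<phi> n))"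
    unfolding l_def d_def by (rule L_quadratic_diff[OF \<phi>_regular(1) \<phi>_regular(1)])
  \<comment> \<open>Here \<open>p\<close> and \<open>q\<close> stand for the new and old quadratic
    energies, \<open>r\<close> and \<open>t\<close> for \<open>Rt (n + 1)\<close> and
    \<open>R n\<close>.\<close>
  also have "- ((1/dt) * (p - q) + (r + t) * ((r - t) / dt)) = (q - p + t\<^sup>2 - r\<^sup>2) / dt" for p q r t
    using assms by (simp add: field_simps power2_eq_square)
  finally have "L2_inner \<Omega> (G (\<mu> n)) (\<mu> n) * dt
      = 1/2 * L2_inner \<Omega> (L (\<phi> n)) (\<phi> n) - 1/2 * L2_inner \<Omega> (L (\<phi> (n + 1))) (\<phi> (n + 1))
        + (R n)\<^sup>2 - (Rt (n + 1))\<^sup>2"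
    by (rule nonzero_eq_divide_eq[THEN iffD1, rotated]) (use assms in simp)
  moreover have "0 \<le> L2_inner \<Omega> (G (\<mu> n)) (\<mu> n) * dt"
    using G_positive[OF \<mu>_regular] assms by simp
  ultimately show ?thesis by linarith
qed

lemma min_as_convex_combination:
  fixes r s S :: real
  assumes "r \<le> s"
  shows "\<exists>l\<in>{0..1}. min s S = l * r + (1 - l) * S"
proof (cases "S \<le> s")
  case True
  then show ?thesis by (intro bexI[of _ 0]) auto
next
  case False
  \<comment> \<open>Now \<open>r \<le> s < S\<close>. The segment starts at \<open>S\<close>, so
    that its parameter is the weight of \<open>r\<close>, as \<open>l\<close> is in the
    claim.\<close>
  with assms have "min s S \<in> closed_segment S r"
    by (auto simp: closed_segment_eq_real_ivl)
  then show ?thesis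
    by (auto simp: in_segment algebra_simps)
qed

text \<open>If \<open>S \<le> s\<close>, the left side vanishes. Otherwise
  \<open>q\<^sup>2 \<le> s\<^sup>2 \<le> S\<^sup>2\<close>, so \<open>s\<^sup>2\<close> is the
  admissible square nearest to \<open>S\<^sup>2\<close>. The bound is on squares because a relaxed
  value may be negative.\<close>

lemma square_min_closest:
  fixes q s S :: real
  assumes "0 \<le> s" "q\<^sup>2 \<le> s\<^sup>2"
  shows "\<bar>(min s S)\<^sup>2 - S\<^sup>2\<bar> \<le> \<bar>q\<^sup>2 - S\<^sup>2\<bar>"
proof (cases "S \<le> s")
  case False
  with assms(1) have "s\<^sup>2 \<le> S\<^sup>2" by (intro power_mono) auto
  with assms(2) False show ?thesis by (simp add: min_def)
qed (simp add: min_def)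

theorem theorem3p3:
  fixes \<Omega> :: "'a::euclidean_space set"
    and L G :: "('a \<Rightarrow> real) \<Rightarrow> 'a \<Rightarrow> real"
    and D\<^sub>L D\<^sub>G :: "('a \<Rightarrow> real) set"
    and F F' :: "real \<Rightarrow> real"
    and C dt :: real
    and \<phi>\<^sub>0 \<phi>\<^sub>p :: "'a \<Rightarrow> real"
    and \<phi> \<mu> :: "nat \<Rightarrow> 'a \<Rightarrow> real"
    and Rt R :: "nat \<Rightarrow> real"
    and n :: nat
  assumes "dt > 0"
    and "EOP_SAV_CN \<Omega> D\<^sub>L L D\<^sub>G G F F' C dt \<phi>\<^sub>0 \<phi>\<^sub>p \<phi> \<mu> Rt R"
  shows "(\<exists>l\<in>{0..1}. R (n + 1) = relaxed_R \<Omega> F C (\<phi> (n + 1)) (Rt (n + 1)) l)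
    \<and> dissipative_law \<Omega> L (\<phi> n) (R n) (\<phi> (n + 1)) (R (n + 1))
    \<and> (\<forall>l\<in>{0..1}.
         dissipative_law \<Omega> L (\<phi> n) (R n) (\<phi> (n + 1))
           (relaxed_R \<Omega> F C (\<phi> (n + 1)) (Rt (n + 1)) l) \<longrightarrow>
         \<bar>modified_energy \<Omega> L C (\<phi> (n + 1)) (R (n + 1)) - free_energy \<Omega> L F (\<phi> (n + 1))\<bar>
         \<le> \<bar>modified_energy \<Omega> L C (\<phi> (n + 1)) (relaxed_R \<Omega> F C (\<phi> (n + 1)) (Rt (n + 1)) l)
             - free_energy \<Omega> L F (\<phi> (n + 1))\<bar>)"
proof -
  interpret EOP_SAV_CN \<Omega> D\<^sub>L L D\<^sub>G G F F' C dt \<phi>\<^sub>0 \<phi>\<^sub>p \<phi> \<mu> Rt R by fact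
  define a where "a = 1/2 * L2_inner \<Omega> (L (\<phi> n)) (\<phi> n)"
  define b where "b = 1/2 * L2_inner \<Omega> (L (\<phi> (n + 1))) (\<phi> (n + 1))"
  define s where "s = sqrt (a - b + (R n)\<^sup>2)"
  define S where "S = sqrt (shifted_E1 \<Omega> F C (\<phi> (n + 1)))"
  have R: "R (n + 1) = min s S"
    using step2[of n] by (simp add: s_def S_def a_def b_def)
  have Rt: "(Rt (n + 1))\<^sup>2 \<le> a - b + (R n)\<^sup>2"
    using step1_dissipation[OF assms(1), of n] by (simp add: a_def b_def)
  \<comment> \<open>The radicand dominates the square of \<open>Rt (n + 1)\<close>. Its sign
    matters, since \<open>sqrt\<close> in HOL takes negative values at negative arguments.\<close>
  then have radicand: "0 \<le> a - b + (R n)\<^sup>2"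
    by (rule order_trans[OF zero_le_power2])
  then have s: "0 \<le> s" "s\<^sup>2 = a - b + (R n)\<^sup>2"
    by (simp_all add: s_def)
  have "Rt (n + 1) \<le> s"
    unfolding s_def using Rt by (rule real_le_rsqrt)
  have "0 < E1 \<Omega> F (\<phi> (n + 1)) + C"
    using E1_bound[OF \<phi>_regular, of "n + 1"] by linarith
  then have S: "0 \<le> S" "S\<^sup>2 = E1 \<Omega> F (\<phi> (n + 1)) + C"
    by (simp_all add: S_def shifted_E1_def)
  \<comment> \<open>The quadratic parts cancel and the shift \<open>C\<close> completes
    \<open>E1\<close> to \<open>S\<^sup>2\<close>. Together with \<open>law\<close> this reduces the
    claim to the real numbers \<open>s\<close>, \<open>S\<close> and \<open>q\<close>.\<close>
  have gap: "modified_energy \<Omega> L C (\<phi> (n + 1)) q - free_energy \<Omega> L F (\<phi> (n + 1)) = q\<^sup>2 - S\<^sup>2"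
    for q
    by (simp add: modified_energy_def free_energy_def S)
  have law: "dissipative_law \<Omega> L (\<phi> n) (R n) (\<phi> (n + 1)) q \<longleftrightarrow> q\<^sup>2 \<le> s\<^sup>2" for q
    by (auto simp: dissipative_law_def s a_def b_def)
  have "(min s S)\<^sup>2 \<le> s\<^sup>2"
    using s S by (intro power_mono) auto
  then show ?thesis
    unfolding gap law R
    using min_as_convex_combination[OF \<open>Rt (n + 1) \<le> s\<close>, of S] square_min_closest[OF s(1), of _ S]
    by (auto simp: relaxed_R_def S_def)
qed

end
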